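(* Let $G$ be a topological group, let $n\ge 1$, and suppose $T_1,\dots,T_n\subseteq G$ are locally cofinite at $0$ and nowhere dense in $G$. Then $E_n = T_1+\cdots+T_n = \{a_1+\cdots+a_n : a_i\in T_i\}$ is nowhere dense in $G$.
   Context: A topological group $\langle G,0,+,-\rangle$ is a group, written additively but not assumed abelian, equipped with a Hausdorff topology for which addition and additive inverse are continuous. A subset $T\subseteq G$ is called locally cofinite at $0$ if (1) $0\notin T$, and (2) for every open neighborhood $u$ of $0$, the set $T\setminus u$ is finite. A subset is nowhere dense if its closure has empty interior. *)

theory Defs
  imports "HOL-Analysis.Analysis"
begin

definition locally_cofinite_at_0 :: "'a::{topological_space,zero} set \<Rightarrow> bool" where
  "locally_cofinite_at_0 T \<longleftrightarrow> 0 \<notin> T \<and> (\<forall>u. open u \<and> 0 \<in> u \<longrightarrow> finite (T - u))"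

definition nowhere_dense :: "'a::topological_space set \<Rightarrow> bool" where
  "nowhere_dense S \<longleftrightarrow> interior (closure S) = {}"

(* The group need not be commutative, so the summands are added in the order of their
   indices, via sum_list (the operator sum requires a commutative monoid).  Values of a
   outside {1..n} are irrelevant. *)
definition set_sum_upto :: "(nat \<Rightarrow> 'a::monoid_add set) \<Rightarrow> nat \<Rightarrow> 'a set" where
  "set_sum_upto T n = {sum_list (map a [1..<Suc n]) | a. \<forall>i\<in>{1..n}. a i \<in> T i}"

end

theory Submission
  imports Defs
begin

text \<open>
  Let \<open>S\<close> be nowhere dense and \<open>T\<close> locally cofinite at \<open>0\<close>. A point \<open>x\<close> outside the closure
  \<open>C\<close> of \<open>S\<close> has a neighbourhood \<open>V\<close> such that \<open>V - W\<close> misses \<open>C\<close> for some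
  neighbourhood \<open>W\<close> of \<open>0\<close>. Hence inside \<open>V\<close> only the finitely many elements of \<open>T\<close>
  outside \<open>W\<close> contribute to \<open>S + T\<close>, so near \<open>x\<close> the sum lies in a finite union
  of translates of \<open>C\<close>, which is closed with empty interior. The theorem follows by induction on
  the number of summands.
\<close>

lemma closed_right_translation:
  fixes S :: "'a::topological_group_add set"
  assumes "closed S"
  shows "closed ((\<lambda>s. s + t) ` S)"
proof -
  have "(\<lambda>s. s + t) ` S = (\<lambda>y. y - t) -` S"
    by (force simp: image_iff)
  then show ?thesis
    using assms by (auto intro!: closed_vimage continuous_intros)
qed

lemma interior_right_translation_empty:
  fixes S :: "'a::topological_group_add set"
  assumes "interior S = {}"
  shows "interior ((\<lambda>s. s + t) ` S) = {}"
proof -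
  let ?U = "interior ((\<lambda>s. s + t) ` S)"
  have "open ((\<lambda>s. s + t) -` ?U)"
    by (intro open_vimage open_interior continuous_intros)
  moreover have "(\<lambda>s. s + t) -` ?U \<subseteq> S"
    using interior_subset[of "(\<lambda>s. s + t) ` S"] by auto
  ultimately have "(\<lambda>s. s + t) -` ?U = {}"
    using assms interior_maximal by blast
  moreover have "y - t \<in> (\<lambda>s. s + t) -` ?U" if "y \<in> ?U" for y
    using that by simp
  ultimately show ?thesis
    by blast
qed

text \<open>Closedness must be carried through the induction: two sets with empty interior can have
  a union with nonempty interior when neither is closed.\<close>

lemma closed_interior_empty_UN_finite:
  assumes "finite F" and "\<And>t. t \<in> F \<Longrightarrow> closed (A t) \<and> interior (A t) = {}"
  shows "closed (\<Union>t\<in>F. A t) \<and> interior (\<Union>t\<in>F. A t) = {}"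
  using assms
  by (induction F) (auto simp: interior_closed_Un_empty_interior)

lemma nowhere_dense_add_locally_cofinite:
  fixes S T :: "'a::topological_group_add set"
  assumes S: "nowhere_dense S" and T: "locally_cofinite_at_0 T"
  shows "nowhere_dense {s + t |s t. s \<in> S \<and> t \<in> T}"
proof (rule ccontr)
  let ?E = "{s + t |s t. s \<in> S \<and> t \<in> T}"
  let ?C = "closure S"
  assume "\<not> nowhere_dense ?E"
  moreover have "interior ?C = {}"
    using S by (simp add: nowhere_dense_def)
  \<comment> \<open>An open subset of \<open>?C\<close> lies in its interior, which is
    empty.\<close>
  ultimately have "\<not> interior (closure ?E) \<subseteq> ?C"
    using interior_maximal[OF _ open_interior] by (auto simp: nowhere_dense_def)
  then obtain x where x: "x \<in> interior (closure ?E)" "x \<notin> ?C"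
    by blast
  \<comment> \<open>Continuity of subtraction at \<open>(x, 0)\<close> yields a box
    \<open>V \<times> W\<close> on which differences avoid \<open>?C\<close>.\<close>
  have "open ((\<lambda>p. fst p - snd p) -` (- ?C) :: ('a \<times> 'a) set)"
    by (intro open_vimage continuous_intros) auto
  moreover have "(x, 0) \<in> (\<lambda>p. fst p - snd p) -` (- ?C)"
    using x by simp
  ultimately obtain V W where V: "open V" "x \<in> V" and W: "open W" "0 \<in> W"
    and VW: "V \<times> W \<subseteq> (\<lambda>p. fst p - snd p) -` (- ?C)"
    by (elim open_prod_elim) auto
  let ?F = "T - W"
  let ?K = "\<Union>t\<in>?F. (\<lambda>s. s + t) ` ?C"
  have "finite ?F"
    using T W by (simp add: locally_cofinite_at_0_def)
  then have K: "closed ?K \<and> interior ?K = {}"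
    using \<open>interior ?C = {}\<close>
    by (intro closed_interior_empty_UN_finite)
      (auto simp: closed_right_translation interior_right_translation_empty)
  have "V \<inter> ?E \<subseteq> ?K"
  proof
    fix y assume "y \<in> V \<inter> ?E"
    then obtain s t where st: "y = s + t" "s \<in> S" "t \<in> T" "y \<in> V"
      by blast
    have s: "s \<in> ?C"
      using st(2) closure_subset by blast
    \<comment> \<open>Otherwise \<open>y - t = s\<close> would be a difference from the box lying in
      \<open>?C\<close>.\<close>
    then have "t \<notin> W"
      using VW st by (auto dest!: subsetD[where c = "(y, t)"])
    with st s show "y \<in> ?K"
      by blast
  qed
  then have "closure (V \<inter> ?E) \<subseteq> ?K"
    using K by (simp add: closure_minimal)
  moreover have "V \<inter> closure ?E \<subseteq> closure (V \<inter> ?E)"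
    using V by (simp add: open_Int_closure_subset)
  ultimately have "V \<inter> interior (closure ?E) \<subseteq> ?K"
    using interior_subset by blast
  then have "V \<inter> interior (closure ?E) \<subseteq> interior ?K"
    using V by (simp add: interior_maximal open_Int)
  \<comment> \<open>The point \<open>x\<close> lies in the left-hand side, while \<open>?K\<close>
    has empty interior.\<close>
  then show False
    using K V x by blast
qed

lemma set_sum_upto_0: "set_sum_upto T 0 = {0}"
  by (simp add: set_sum_upto_def)

text \<open>The last summand is split off on the right, so the order of addition is kept and the
  induction can add one set at a time.\<close>

lemma set_sum_upto_Suc:
  "set_sum_upto T (Suc n) = {s + t |s t. s \<in> set_sum_upto T n \<and> t \<in> T (Suc n)}"
proof (intro set_eqI iffI)
  fix x assume "x \<in> set_sum_upto T (Suc n)"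
  then obtain a where a: "x = sum_list (map a [1..<Suc (Suc n)])" "\<forall>i\<in>{1..Suc n}. a i \<in> T i"
    unfolding set_sum_upto_def by blast
  then have "x = sum_list (map a [1..<Suc n]) + a (Suc n)"
    by simp
  moreover have "sum_list (map a [1..<Suc n]) \<in> set_sum_upto T n"
    unfolding set_sum_upto_def using a(2) by (intro CollectI exI[of _ a]) simp
  moreover have "a (Suc n) \<in> T (Suc n)"
    using a(2) by simp
  ultimately show "x \<in> {s + t |s t. s \<in> set_sum_upto T n \<and> t \<in> T (Suc n)}"
    by blast
next
  fix x assume "x \<in> {s + t |s t. s \<in> set_sum_upto T n \<and> t \<in> T (Suc n)}"
  then obtain a t where a: "\<forall>i\<in>{1..n}. a i \<in> T i" and t: "t \<in> T (Suc n)"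
    and x: "x = sum_list (map a [1..<Suc n]) + t"
    unfolding set_sum_upto_def by blast
  \<comment> \<open>Overwriting index \<open>Suc n\<close> leaves the first \<open>n\<close>
    summands untouched.\<close>
  let ?b = "a(Suc n := t)"
  have "map ?b [1..<Suc n] = map a [1..<Suc n]"
    by (rule map_cong) auto
  then have "x = sum_list (map ?b [1..<Suc (Suc n)])"
    by (subst upt_Suc) (simp add: x del: upt_Suc)
  moreover have "\<forall>i\<in>{1..Suc n}. ?b i \<in> T i"
    using a t by (auto simp: le_Suc_eq)
  ultimately show "x \<in> set_sum_upto T (Suc n)"
    unfolding set_sum_upto_def by blast
qed

theorem theorem2p2:
  fixes T :: "nat \<Rightarrow> 'a::{topological_group_add,t2_space} set"
    and n :: nat
  assumes "n \<ge> 1"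
    and "\<And>i. i \<in> {1..n} \<Longrightarrow> locally_cofinite_at_0 (T i)"
    and "\<And>i. i \<in> {1..n} \<Longrightarrow> nowhere_dense (T i)"
  shows "nowhere_dense (set_sum_upto T n)"
  using assms
proof (induction n rule: nat_induct_at_least)
  case base
  have "set_sum_upto T 1 = T 1"
    using set_sum_upto_Suc[of T 0] by (simp add: set_sum_upto_0)
  with base show ?case
    by simp
next
  case (Suc n)
  then show ?case
    unfolding set_sum_upto_Suc by (intro nowhere_dense_add_locally_cofinite) simp_all
qed

end
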